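(* Let $\sigma > 0$ and let $s$ be the unique maximal real solution of $s''(t) = 2 s(t)^3 + t\, s(t)$ with $s(0) = 0$ and $s'(0) = \sigma$, defined on its maximal open interval of existence $I_s \ni 0$. Let $t_\infty > 0$ be the real number such that $I_s \cap [0,\infty) = [0, t_\infty)$. Then $$t_\infty > \frac{2}{\sqrt{\sigma^2 + 5/3}}.$$
   Context: All functions are real-valued functions of a real variable $t$. The maximal interval $I_s$ is the largest open interval about $0$ on which the solution of the initial value problem exists. The number $t_\infty = \sup I_s$ is the positive blow-up time of $s$; it is finite for every $\sigma > 0$. *)

theory Defs
  imports "HOL-Analysis.Analysis"
begin

(* A solution of  s'' = 2 s^3 + t s,  s(0) = 0,  s'(0) = \<sigma>  on the open interval I.
   Only the values of s on I matter; s' is the witness for its derivative on I. *)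
definition ivp_solution_on :: "real \<Rightarrow> (real \<Rightarrow> real) \<Rightarrow> real set \<Rightarrow> bool" where
  "ivp_solution_on \<sigma> s I \<longleftrightarrow>
     open I \<and> is_interval I \<and> 0 \<in> I \<and> s 0 = 0 \<and>
     (\<exists>s'. s' 0 = \<sigma> \<and>
       (\<forall>t\<in>I. (s has_real_derivative s' t) (at t) \<and>
               (s' has_real_derivative (2 * s t ^ 3 + t * s t)) (at t)))"

(* u is not required to agree with s on the overlap: uniqueness of solutions forces it. *)
definition maximal_ivp_solution :: "real \<Rightarrow> (real \<Rightarrow> real) \<Rightarrow> real set \<Rightarrow> bool" where
  "maximal_ivp_solution \<sigma> s I \<longleftrightarrow>
     ivp_solution_on \<sigma> s I \<and> (\<forall>u J. ivp_solution_on \<sigma> u J \<longrightarrow> J \<subseteq> I)"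

end

theory Submission
  imports Defs
begin

text \<open>
  On \<open>0 \<le> t \<le> T\<close> the term \<open>t s\<close> is at most \<open>T s\<close>, so multiplying the equation by \<open>s'\<close> and
  integrating gives the energy inequality \<open>s'\<^sup>2 \<le> \<sigma>\<^sup>2 + T s\<^sup>2 + s\<^sup>4\<close>. If \<open>k\<close> dominates both \<open>\<sigma>\<close>
  and \<open>T / 2\<close>, the right-hand side is at most \<open>(s\<^sup>2 + k)\<^sup>2\<close>. Hence \<open>s' \<le> s\<^sup>2 + k\<close>, and comparison
  with the Riccati equation gives \<open>s t \<le> sqrt k * tan (sqrt k * t)\<close>: there is no blow-up up to
  time \<open>T\<close> as long as \<open>sqrt k * T < pi / 2\<close>. For a time \<open>T\<close> slightly larger than
  \<open>2 / sqrt (\<sigma>\<^sup>2 + 5 / 3)\<close> and \<open>k = max \<sigma> (T / 2)\<close> one even has \<open>sqrt k * T \<le> 3 / 2\<close>.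

  An a priori bound becomes a bound on the interval of existence through a globally Lipschitz
  truncation of the force at the level of the bound. The truncated problem is solved on all of
  \<open>[0, T]\<close> by the contraction principle (\<open>lipschitz_ivp_solution_exists\<close>); the estimate holds for
  its solution too (\<open>riccati_bound\<close>), which therefore never feels the truncation. Continued to
  negative times by the given \<open>s\<close>, it solves the original problem, and by maximality its domain
  lies in \<open>I_s\<close> (\<open>no_blowup_before\<close>).
\<close>

section \<open>Initial value problems with a globally Lipschitz field\<close>

text \<open>
  The Picard operator contracts distances by the factor \<open>1 / 2\<close> on all of \<open>[0, T]\<close> at once in the norm
  \<open>sup (exp (- 2 * L * t) * norm (x t))\<close>. The fixed point is sought for the weighted function
  \<open>w t = exp (- 2 * L * t) *\<^sub>R x t\<close>, on which this norm is the supremum norm.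
\<close>

lemma lipschitz_ivp_solution_exists:
  fixes f :: "real \<Rightarrow> 'a::banach \<Rightarrow> 'a" and x0 :: 'a
  assumes T: "0 \<le> T" and L: "0 < L"
    and cont: "continuous_on ({0..T} \<times> UNIV) (\<lambda>(t, x). f t x)"
    and lip: "\<And>t x y. t \<in> {0..T} \<Longrightarrow> norm (f t x - f t y) \<le> L * norm (x - y)"
  shows "\<exists>x. x 0 = x0 \<and>
    (\<forall>t\<in>{0..T}. (x has_vector_derivative f t (x t)) (at t within {0..T}))"
proof -
  define G where "G w r = f r (exp (2 * L * r) *\<^sub>R apply_bcontfun w r)"
    for w :: "real \<Rightarrow>\<^sub>C 'a" and r
  have G_cont: "continuous_on {0..T} (G w)" for w
  proof -
    have "continuous_on {0..T} ((\<lambda>(t, x). f t x) \<circ> (\<lambda>r. (r, exp (2 * L * r) *\<^sub>R apply_bcontfun w r)))"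
      by (intro continuous_on_compose continuous_intros continuous_on_subset[OF cont]) auto
    then show ?thesis by (simp add: G_def o_def)
  qed
  define F where "F w t = exp (- (2 * L * t)) *\<^sub>R (x0 + integral {0..t} (G w))" for w t
  have G_int: "G w integrable_on {0..t}" if "t \<in> {0..T}" for w t
    using that by (intro integrable_continuous_real continuous_on_subset[OF G_cont]) auto
  have int_deriv: "((\<lambda>u. integral {0..u} (G w)) has_vector_derivative G w t) (at t within {0..T})"
    if "t \<in> {0..T}" for w t
    using integral_has_vector_derivative[OF G_cont that] .
  have "continuous_on (cbox 0 T) (F w)" for w
    unfolding F_def cbox_interval
    by (intro continuous_intros indefinite_integral_continuous_1 G_int) (use T in auto)
  then have "\<forall>w. \<exists>g. \<forall>t. apply_bcontfun g t = F w (clamp 0 T t)"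
    by (metis continuous_on_cbox_bcontfunE)
  then obtain P where P: "\<And>w t. apply_bcontfun (P w) t = F w (clamp 0 T t)"
    by metis
  have contraction: "dist (P v) (P w) \<le> 1 / 2 * dist v w" for v w
  proof (rule dist_bound)
    fix t
    define c where "c = clamp 0 T t"
    have c: "c \<in> {0..T}"
      using clamp_in_interval[of 0 T t] T by (auto simp: c_def)
    define d where "d = dist v w"
    have "norm (integral {0..c} (\<lambda>r. G v r - G w r))
        \<le> integral {0..c} (\<lambda>r. L * d * exp (2 * L * r))"
    proof (rule integral_norm_bound_integral)
      show "(\<lambda>r. G v r - G w r) integrable_on {0..c}"
        by (intro integrable_diff G_int c)
      show "(\<lambda>r. L * d * exp (2 * L * r)) integrable_on {0..c}"
        by (intro integrable_continuous_real continuous_intros)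
      fix r assume "r \<in> {0..c}"
      then have r: "r \<in> {0..T}" using c by auto
      have "norm (G v r - G w r) \<le> L * norm (exp (2 * L * r) *\<^sub>R (apply_bcontfun v r - apply_bcontfun w r))"
        unfolding G_def scaleR_diff_right by (rule lip[OF r])
      also have "\<dots> = L * exp (2 * L * r) * dist (apply_bcontfun v r) (apply_bcontfun w r)"
        by (simp add: dist_norm)
      also have "\<dots> \<le> L * exp (2 * L * r) * d"
        unfolding d_def using L by (intro mult_left_mono dist_bounded) auto
      finally show "norm (G v r - G w r) \<le> L * d * exp (2 * L * r)"
        by (simp add: mult_ac)
    qed
    also have "\<dots> = d / 2 * exp (2 * L * c) - d / 2 * exp (2 * L * 0)"
    proof (intro integral_unique fundamental_theorem_of_calculus)
      show "0 \<le> c" using c by simp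
      show "((\<lambda>r. d / 2 * exp (2 * L * r)) has_vector_derivative L * d * exp (2 * L * r))
          (at r within {0..c})" for r
        by (auto simp: has_real_derivative_iff_has_vector_derivative[symmetric]
            intro!: derivative_eq_intros)
    qed
    also have "\<dots> \<le> d / 2 * exp (2 * L * c)"
      by (simp add: d_def)
    finally have bound: "norm (integral {0..c} (\<lambda>r. G v r - G w r)) \<le> d / 2 * exp (2 * L * c)" .
    have "F v c - F w c = exp (- (2 * L * c)) *\<^sub>R integral {0..c} (\<lambda>r. G v r - G w r)"
      by (simp add: F_def integral_diff[OF G_int[OF c] G_int[OF c]] flip: scaleR_diff_right)
    then have "dist (F v c) (F w c)
        = exp (- (2 * L * c)) * norm (integral {0..c} (\<lambda>r. G v r - G w r))"
      by (simp add: dist_norm)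
    also have "\<dots> \<le> exp (- (2 * L * c)) * (d / 2 * exp (2 * L * c))"
      by (intro mult_left_mono bound) auto
    also have "\<dots> = 1 / 2 * d"
      by (simp add: exp_minus)
    finally show "dist (apply_bcontfun (P v) t) (apply_bcontfun (P w) t) \<le> 1 / 2 * dist v w"
      by (simp add: P c_def d_def)
  qed
  obtain w where w: "P w = w"
    using banach_fix_type[of "1 / 2" P] contraction by auto
  define x where "x t = x0 + integral {0..t} (G w)" for t
  have x: "exp (2 * L * t) *\<^sub>R apply_bcontfun w t = x t" if "t \<in> {0..T}" for t
  proof -
    have "apply_bcontfun w t = F w t"
      using P[of w t] that by (simp add: w)
    then show ?thesis by (simp add: F_def x_def flip: exp_add)
  qed
  have "(x has_vector_derivative f t (x t)) (at t within {0..T})" if "t \<in> {0..T}" for t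
  proof -
    have "(x has_vector_derivative G w t) (at t within {0..T})"
      unfolding x_def using int_deriv[OF that, of w]
      by (auto intro!: derivative_eq_intros)
    then show ?thesis by (simp add: G_def x[OF that])
  qed
  moreover have "x 0 = x0" by (simp add: x_def)
  ultimately show ?thesis by blast
qed

section \<open>Truncating the equation\<close>

text \<open>
  The cut-off at \<open>R\<close> makes the force globally Lipschitz. The cut-off at \<open>0\<close> makes it nonnegative
  for \<open>t \<ge> 0\<close> whatever the sign of \<open>x\<close>, so that \<open>v'\<close> increases and \<open>v \<ge> 0\<close> follows at once, without
  a continuity argument on the first zero of \<open>v\<close>.
\<close>

definition truncate :: "real \<Rightarrow> real \<Rightarrow> real" where
  "truncate R x = max 0 (min R x)"

lemma truncate_lipschitz: "\<bar>truncate R x - truncate R y\<bar> \<le> \<bar>x - y\<bar>"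
  by (auto simp: truncate_def)

lemma truncate_nonneg: "0 \<le> truncate R x"
  by (simp add: truncate_def)

lemma truncate_le: "0 \<le> R \<Longrightarrow> truncate R x \<le> R"
  by (simp add: truncate_def)

lemma truncate_le_self: "0 \<le> x \<Longrightarrow> truncate R x \<le> x"
  by (simp add: truncate_def)

lemma truncate_eq_self: "0 \<le> x \<Longrightarrow> x \<le> R \<Longrightarrow> truncate R x = x"
  by (simp add: truncate_def)

lemma truncated_force_lipschitz:
  assumes R: "0 \<le> R" and t: "t \<in> {0..T}"
  shows "\<bar>(2 * truncate R x ^ 3 + t * truncate R x) - (2 * truncate R y ^ 3 + t * truncate R y)\<bar>
      \<le> (6 * R\<^sup>2 + T) * \<bar>x - y\<bar>"
proof -
  define p q where "p = truncate R x" and "q = truncate R y"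
  have pq: "0 \<le> p" "p \<le> R" "0 \<le> q" "q \<le> R"
    using truncate_nonneg truncate_le[OF R] by (auto simp: p_def q_def)
  have "p\<^sup>2 \<le> R\<^sup>2" "q\<^sup>2 \<le> R\<^sup>2" "p * q \<le> R\<^sup>2"
    using pq by (auto simp: power2_eq_square intro!: mult_mono)
  then have "2 * (p\<^sup>2 + p * q + q\<^sup>2) + t \<le> 6 * R\<^sup>2 + T"
    using t by (auto intro: order_trans[of _ "6 * R\<^sup>2 + t"])
  moreover have "0 \<le> 2 * (p\<^sup>2 + p * q + q\<^sup>2) + t"
    using pq t by simp
  moreover have "(2 * p ^ 3 + t * p) - (2 * q ^ 3 + t * q) = (2 * (p\<^sup>2 + p * q + q\<^sup>2) + t) * (p - q)"
    by (simp add: algebra_simps power2_eq_square power3_eq_cube)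
  ultimately have "\<bar>(2 * p ^ 3 + t * p) - (2 * q ^ 3 + t * q)\<bar> \<le> (6 * R\<^sup>2 + T) * \<bar>p - q\<bar>"
    by (simp add: abs_mult mult_right_mono)
  also have "\<dots> \<le> (6 * R\<^sup>2 + T) * \<bar>x - y\<bar>"
    using t truncate_lipschitz[of R x y] by (intro mult_left_mono) (auto simp: p_def q_def)
  finally show ?thesis by (simp add: p_def q_def)
qed

lemma truncated_solution_exists:
  assumes R: "0 \<le> R" and T: "0 \<le> T"
  shows "\<exists>v v'. v 0 = 0 \<and> v' 0 = \<sigma> \<and>
    (\<forall>t\<in>{0..T}. (v has_real_derivative v' t) (at t within {0..T}) \<and>
      (v' has_real_derivative (2 * truncate R (v t) ^ 3 + t * truncate R (v t)))
        (at t within {0..T}))"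
proof -
  define h where "h t x = 2 * truncate R x ^ 3 + t * truncate R x" for t x
  define f where "f t z = (snd z, h t (fst z))" for t and z :: "real \<times> real"
  have "continuous_on ({0..T} \<times> UNIV) (\<lambda>(t, z). f t z)"
    unfolding f_def h_def truncate_def case_prod_beta by (intro continuous_intros)
  moreover have "norm (f t y - f t z) \<le> (6 * R\<^sup>2 + T + 1) * norm (y - z)" if "t \<in> {0..T}" for t y z
  proof -
    have "norm (f t y - f t z) \<le> \<bar>snd y - snd z\<bar> + \<bar>h t (fst y) - h t (fst z)\<bar>"
      using norm_Pair_le[of "snd y - snd z" "h t (fst y) - h t (fst z)"] by (simp add: f_def)
    also have "\<dots> \<le> \<bar>snd y - snd z\<bar> + (6 * R\<^sup>2 + T) * \<bar>fst y - fst z\<bar>"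
      using truncated_force_lipschitz[OF R that] by (simp add: h_def)
    also have "\<dots> \<le> norm (y - z) + (6 * R\<^sup>2 + T) * norm (y - z)"
      using norm_snd_le[of "snd (y - z)" "fst (y - z)"] norm_fst_le[of "fst (y - z)" "snd (y - z)"] T
      unfolding prod.collapse by (intro add_mono mult_left_mono) auto
    finally show ?thesis by (simp add: algebra_simps)
  qed
  moreover have "0 < 6 * R\<^sup>2 + T + 1"
    using T by (smt (verit) zero_le_power2)
  ultimately obtain z where z0: "z 0 = (0, \<sigma>)"
    and z: "\<And>t. t \<in> {0..T} \<Longrightarrow> (z has_vector_derivative f t (z t)) (at t within {0..T})"
    using lipschitz_ivp_solution_exists[OF T, of "6 * R\<^sup>2 + T + 1" f "(0, \<sigma>)"] by blast
  have "((\<lambda>t. fst (z t)) has_real_derivative snd (z t)) (at t within {0..T})"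
    and "((\<lambda>t. snd (z t)) has_real_derivative h t (fst (z t))) (at t within {0..T})"
    if "t \<in> {0..T}" for t
    using bounded_linear.has_vector_derivative[OF bounded_linear_fst z[OF that]]
      bounded_linear.has_vector_derivative[OF bounded_linear_snd z[OF that]]
    by (simp_all add: has_real_derivative_iff_has_vector_derivative f_def)
  then show ?thesis
    using z0 by (intro exI[of _ "\<lambda>t. fst (z t)"] exI[of _ "\<lambda>t. snd (z t)"]) (simp add: h_def)
qed

section \<open>The a priori bound\<close>

lemma within_deriv_nonneg_imp_ge_initial:
  fixes g :: "real \<Rightarrow> real"
  assumes g: "\<And>r. r \<in> {0..T} \<Longrightarrow> (g has_real_derivative g' r) (at r within {0..T})"
    and nonneg: "\<And>r. r \<in> {0..T} \<Longrightarrow> 0 \<le> g' r"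
    and t: "t \<in> {0..T}"
  shows "g 0 \<le> g t"
proof (rule DERIV_nonneg_imp_increasing_open[where f = g])
  show "0 \<le> t" using t by simp
  show "continuous_on {0..t} g"
    using t by (intro continuous_on_subset[OF DERIV_continuous_on[OF g]]) auto
  fix r assume r: "0 < r" "r < t"
  then have "at r within {0..T} = at r"
    using t by (intro at_within_Icc_at) auto
  then show "\<exists>y. DERIV g r :> y \<and> 0 \<le> y"
    using g[of r] nonneg[of r] r t by auto
qed

text \<open>
  The hypotheses only ask that the force is nonnegative and, where \<open>v \<ge> 0\<close>, at most
  \<open>2 * v ^ 3 + T * v\<close>, so that the bound applies to the truncated equation, with the same constants for every truncation level.
\<close>

lemma riccati_bound:
  fixes v v' a :: "real \<Rightarrow> real"
  assumes \<sigma>: "0 < \<sigma>" "\<sigma> \<le> k" and T: "T \<le> 2 * k" "sqrt k * T < pi / 2"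
    and init: "v 0 = 0" "v' 0 = \<sigma>"
    and v: "\<And>t. t \<in> {0..T} \<Longrightarrow> (v has_real_derivative v' t) (at t within {0..T})"
    and v': "\<And>t. t \<in> {0..T} \<Longrightarrow> (v' has_real_derivative a t) (at t within {0..T})"
    and a_nonneg: "\<And>t. t \<in> {0..T} \<Longrightarrow> 0 \<le> a t"
    and a_le: "\<And>t. t \<in> {0..T} \<Longrightarrow> 0 \<le> v t \<Longrightarrow> a t \<le> 2 * v t ^ 3 + T * v t"
    and t: "t \<in> {0..T}"
  shows "0 \<le> v t" and "v t \<le> sqrt k * tan (sqrt k * T)"
proof -
  have k: "0 < k" using \<sigma> by simp
  have v'_pos: "\<sigma> \<le> v' t" if "t \<in> {0..T}" for t
    using within_deriv_nonneg_imp_ge_initial[OF v' a_nonneg that] init by simp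
  have v_nonneg: "0 \<le> v t" if "t \<in> {0..T}" for t
  proof -
    have "0 \<le> v' r" if "r \<in> {0..T}" for r
      using v'_pos[OF that] \<sigma> by simp
    from within_deriv_nonneg_imp_ge_initial[OF v this that] show ?thesis
      by (simp add: init)
  qed
  show "0 \<le> v t" by (rule v_nonneg[OF t])
  have speed: "v' t \<le> (v t)\<^sup>2 + k" if t: "t \<in> {0..T}" for t
  proof -
    (* By the bound on the force, the energy v'^2 - v^4 - T * v^2 decreases; E is its negative. *)
    define E where "E t = v t ^ 4 + T * (v t)\<^sup>2 - (v' t)\<^sup>2" for t
    have "E 0 \<le> E t"
    proof (rule within_deriv_nonneg_imp_ge_initial[OF _ _ t])
      fix r assume r: "r \<in> {0..T}"
      show "(E has_real_derivative 2 * v' r * (2 * v r ^ 3 + T * v r - a r)) (at r within {0..T})"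
        unfolding E_def
        by (auto intro!: derivative_eq_intros v[OF r] v'[OF r] simp: algebra_simps)
      show "0 \<le> 2 * v' r * (2 * v r ^ 3 + T * v r - a r)"
        using v'_pos[OF r] \<sigma> a_le[OF r v_nonneg[OF r]] by simp
    qed
    then have "(v' t)\<^sup>2 \<le> \<sigma>\<^sup>2 + T * (v t)\<^sup>2 + v t ^ 4"
      by (simp add: E_def init)
    also have "\<dots> \<le> k\<^sup>2 + 2 * k * (v t)\<^sup>2 + v t ^ 4"
      using \<sigma> T by (intro add_mono mult_right_mono power_mono order_refl) auto
    also have "\<dots> = ((v t)\<^sup>2 + k)\<^sup>2"
      by algebra
    finally show ?thesis
      using k by (auto intro: power2_le_imp_le)
  qed
  (* Riccati comparison: arctan (v / sqrt k) grows at a rate of at most sqrt k. *)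
  define w where "w t = sqrt k * t - arctan (v t / sqrt k)" for t
  have "w 0 \<le> w t"
  proof (rule within_deriv_nonneg_imp_ge_initial[OF _ _ t])
    fix r assume r: "r \<in> {0..T}"
    show "(w has_real_derivative sqrt k - 1 / (1 + (v r / sqrt k)\<^sup>2) * (v' r / sqrt k))
        (at r within {0..T})"
      unfolding w_def
      by (auto intro!: derivative_eq_intros v[OF r] simp: divide_inverse algebra_simps)
    have "1 + (v r / sqrt k)\<^sup>2 = ((v r)\<^sup>2 + k) / k"
      using k by (simp add: field_simps power_divide)
    then have "1 / (1 + (v r / sqrt k)\<^sup>2) * (v' r / sqrt k) = k / sqrt k * (v' r / ((v r)\<^sup>2 + k))"
      by simp
    also have "k / sqrt k = sqrt k"
      using k by (simp add: real_div_sqrt)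
    finally have "1 / (1 + (v r / sqrt k)\<^sup>2) * (v' r / sqrt k) = sqrt k * (v' r / ((v r)\<^sup>2 + k))" .
    also have "\<dots> \<le> sqrt k * 1"
      using speed[OF r] k by (intro mult_left_mono) (auto simp: divide_le_eq_1 add_nonneg_pos)
    finally show "0 \<le> sqrt k - 1 / (1 + (v r / sqrt k)\<^sup>2) * (v' r / sqrt k)" by simp
  qed
  then have "arctan (v t / sqrt k) \<le> sqrt k * t"
    by (simp add: w_def init)
  also have "\<dots> \<le> sqrt k * T"
    using t k by (intro mult_left_mono) auto
  finally have "tan (arctan (v t / sqrt k)) \<le> tan (sqrt k * T)"
    using T arctan_bounded[of "v t / sqrt k"] by (cases "arctan (v t / sqrt k) = sqrt k * T")
      (auto simp: less_le intro!: tan_monotone less_imp_le)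
  then show "v t \<le> sqrt k * tan (sqrt k * T)"
    using k by (simp add: tan_arctan field_simps)
qed

text \<open>
  The bound of \<open>riccati_bound\<close> is chosen as the truncation level, so the solution of the truncated
  problem stays in the range where the truncation is the identity.
\<close>

lemma forward_solution_exists:
  assumes \<sigma>: "0 < \<sigma>" "\<sigma> \<le> k" and T: "0 \<le> T" "T \<le> 2 * k" "sqrt k * T < pi / 2"
  shows "\<exists>v v'. v 0 = 0 \<and> v' 0 = \<sigma> \<and>
    (\<forall>t\<in>{0..T}. (v has_real_derivative v' t) (at t within {0..T}) \<and>
      (v' has_real_derivative (2 * v t ^ 3 + t * v t)) (at t within {0..T}))"
proof -
  define R where "R = sqrt k * tan (sqrt k * T)"
  have R: "0 \<le> R"
    using \<sigma> T by (auto simp: R_def less_le intro!: mult_nonneg_nonneg tan_pos_pi2_le)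
  obtain v v' where init: "v 0 = 0" "v' 0 = \<sigma>"
    and v: "\<And>t. t \<in> {0..T} \<Longrightarrow> (v has_real_derivative v' t) (at t within {0..T})"
    and v': "\<And>t. t \<in> {0..T} \<Longrightarrow>
      (v' has_real_derivative (2 * truncate R (v t) ^ 3 + t * truncate R (v t))) (at t within {0..T})"
    using truncated_solution_exists[OF R T(1), of \<sigma>] by blast
  have force_nonneg: "0 \<le> 2 * truncate R (v t) ^ 3 + t * truncate R (v t)" if "t \<in> {0..T}" for t
    using that by (simp add: truncate_nonneg)
  have force_le: "2 * truncate R (v t) ^ 3 + t * truncate R (v t) \<le> 2 * v t ^ 3 + T * v t"
    if "t \<in> {0..T}" "0 \<le> v t" for t
    using that by (intro add_mono mult_mono power_mono truncate_le_self) (auto simp: truncate_nonneg)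
  have "truncate R (v t) = v t" if "t \<in> {0..T}" for t
    using riccati_bound[OF \<sigma> T(2,3) init v v' force_nonneg force_le that]
    by (simp add: truncate_eq_self R_def)
  with init v v' show ?thesis by (intro exI[of _ v] exI[of _ v']) simp
qed

section \<open>Extension to the maximal solution\<close>

lemma has_real_derivative_If_le:
  fixes f g :: "real \<Rightarrow> real"
  assumes f: "(f has_real_derivative D) (at a)"
    and g: "(g has_real_derivative D) (at a within {a..b})"
    and "a < b" "f a = g a"
  shows "((\<lambda>t. if t \<le> a then f t else g t) has_real_derivative D) (at a)" (is "(?u has_real_derivative D) _")
proof -
  have "(?u has_real_derivative D) (at_left a)"
    using DERIV_subset[OF f subset_UNIV] unfolding has_field_derivative_iff
    by (rule Lim_transform_eventually) (auto simp: eventually_at_filter)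
  moreover have "(?u has_real_derivative D) (at_right a)"
  proof -
    have "(g has_real_derivative D) (at_right a)"
      using g \<open>a < b\<close> by (simp add: at_within_Icc_at_right)
    then show ?thesis
      unfolding has_field_derivative_iff
      by (rule Lim_transform_eventually)
        (auto simp: eventually_at_filter \<open>f a = g a\<close>)
  qed
  ultimately show ?thesis
    by (simp add: has_field_derivative_iff filterlim_split_at)
qed

text \<open>
  The competitor for maximality must live on an open interval around \<open>0\<close>. It follows \<open>s\<close> up to time
  \<open>0\<close> and the solution constructed on \<open>[0, T]\<close> afterwards; the two meet with equal value and
  velocity, and the equation then forces equal second derivatives.
\<close>

lemma no_blowup_before:
  assumes sol: "maximal_ivp_solution \<sigma> s I"
    and \<sigma>: "0 < \<sigma>" "\<sigma> \<le> k" and T: "0 < T" "T \<le> 2 * k" "sqrt k * T < pi / 2"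
  shows "{0..<T} \<subseteq> I"
proof -
  from sol have "ivp_solution_on \<sigma> s I"
    and maximal: "\<And>u J. ivp_solution_on \<sigma> u J \<Longrightarrow> J \<subseteq> I"
    by (auto simp: maximal_ivp_solution_def)
  then obtain s' where I: "open I" "is_interval I" "0 \<in> I" and s0: "s 0 = 0" "s' 0 = \<sigma>"
    and s: "\<And>t. t \<in> I \<Longrightarrow> (s has_real_derivative s' t) (at t)"
    and s': "\<And>t. t \<in> I \<Longrightarrow> (s' has_real_derivative (2 * s t ^ 3 + t * s t)) (at t)"
    unfolding ivp_solution_on_def by auto
  obtain v v' where v0: "v 0 = 0" "v' 0 = \<sigma>"
    and v: "\<And>t. t \<in> {0..T} \<Longrightarrow> (v has_real_derivative v' t) (at t within {0..T})"
    and v': "\<And>t. t \<in> {0..T} \<Longrightarrow> (v' has_real_derivative (2 * v t ^ 3 + t * v t)) (at t within {0..T})"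
    using forward_solution_exists[OF \<sigma> less_imp_le[OF T(1)] T(2,3)] by blast
  define u where "u t = (if t \<le> 0 then s t else v t)" for t
  define u' where "u' t = (if t \<le> 0 then s' t else v' t)" for t
  define J where "J = (I \<inter> {..<T}) \<union> {0<..<T}"
  have deriv: "(u has_real_derivative u' t) (at t) \<and>
      (u' has_real_derivative (2 * u t ^ 3 + t * u t)) (at t)" if t: "t \<in> J" for t
  proof -
    consider "t < 0" | "t = 0" | "0 < t" by linarith
    then show ?thesis
    proof cases
      case 1
      then have "t \<in> I" using t by (auto simp: J_def)
      have "(u has_real_derivative s' t) (at t)"
        by (rule has_field_derivative_transform_within_open[OF s[OF \<open>t \<in> I\<close>], of "{..<0}"])
          (use 1 in \<open>auto simp: u_def\<close>)
      moreover have "(u' has_real_derivative (2 * s t ^ 3 + t * s t)) (at t)"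
        by (rule has_field_derivative_transform_within_open[OF s'[OF \<open>t \<in> I\<close>], of "{..<0}"])
          (use 1 in \<open>auto simp: u'_def\<close>)
      ultimately show ?thesis using 1 by (simp add: u_def u'_def)
    next
      case 2
      have "(u has_real_derivative \<sigma>) (at 0)"
        unfolding u_def
        by (rule has_real_derivative_If_le[where b = T])
          (use s[OF I(3)] v[of 0] s0 v0 T in auto)
      moreover have "(u' has_real_derivative 0) (at 0)"
        unfolding u'_def
        by (rule has_real_derivative_If_le[where b = T])
          (use s'[OF I(3)] v'[of 0] s0 v0 T in auto)
      ultimately show ?thesis using 2 s0 by (simp add: u_def u'_def)
    next
      case 3
      then have tT: "t \<in> {0..T}" "0 < t" "t < T" using t by (auto simp: J_def)
      have "(u has_real_derivative v' t) (at t)"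
        by (rule has_field_derivative_transform_within_open[of v _ _ "{0<..}"])
          (use v[OF tT(1)] tT in \<open>auto simp: u_def at_within_Icc_at\<close>)
      moreover have "(u' has_real_derivative (2 * v t ^ 3 + t * v t)) (at t)"
        by (rule has_field_derivative_transform_within_open[of v' _ _ "{0<..}"])
          (use v'[OF tT(1)] tT in \<open>auto simp: u'_def at_within_Icc_at\<close>)
      ultimately show ?thesis using 3 by (simp add: u_def u'_def)
    qed
  qed
  have "is_interval J"
    unfolding is_interval_1
  proof (intro ballI allI impI)
    fix a b x assume a: "a \<in> J" and b: "b \<in> J" and x: "a \<le> x \<and> x \<le> b"
    show "x \<in> J"
    proof (cases "0 < x")
      case True
      then show ?thesis using b x by (auto simp: J_def)
    next
      case False
      then have "a \<in> I" using a x by (auto simp: J_def)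
      then have "x \<in> I"
        using I(2,3) False x unfolding is_interval_1 by (meson not_less)
      then show ?thesis using False T by (simp add: J_def)
    qed
  qed
  moreover have "open J"
    unfolding J_def by (intro open_Un open_Int I) auto
  moreover have "0 \<in> J" "u 0 = 0" "u' 0 = \<sigma>"
    using I T s0 by (simp_all add: J_def u_def u'_def)
  ultimately have "ivp_solution_on \<sigma> u J"
    unfolding ivp_solution_on_def using deriv by (intro conjI exI[of _ u'] ballI) simp_all
  from maximal[OF this] have "{0<..<T} \<subseteq> I"
    by (simp add: J_def)
  moreover have "{0..<T} = insert 0 {0<..<T}"
    using T(1) by auto
  ultimately show ?thesis
    using I(3) by simp
qed

theorem theorem3:
  fixes \<sigma> t_inf :: real and s :: "real \<Rightarrow> real" and I_s :: "real set"
  assumes "\<sigma> > 0"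
    and "maximal_ivp_solution \<sigma> s I_s"
    and "t_inf > 0"
    and "I_s \<inter> {0..} = {0..<t_inf}"
  shows "t_inf > 2 / sqrt (\<sigma>\<^sup>2 + 5 / 3)"
proof -
  define Q where "Q = \<sigma>\<^sup>2 + 5 / 3"
  have Q: "5 / 3 \<le> Q" by (simp add: Q_def)
  (* Any constant slightly above 2 would do: the margin makes the conclusion strict. *)
  define T where "T = 2.05 / sqrt Q"
  define k where "k = max \<sigma> (T / 2)"
  have T_pos: "0 < T" using Q by (simp add: T_def)
  have T2: "T\<^sup>2 = 4.2025 / Q"
    using Q by (simp add: T_def power_divide power2_eq_square)
  have "\<sigma> * T\<^sup>2 \<le> 9 / 4"
  proof -
    have "0 \<le> (\<sigma> - 1)\<^sup>2" by simp
    then have "4.2025 * \<sigma> \<le> 9 / 4 * Q"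
      using assms(1) by (simp add: Q_def power2_eq_square algebra_simps)
    then show ?thesis using Q by (simp add: T2 divide_le_eq algebra_simps)
  qed
  moreover have "T / 2 * T\<^sup>2 \<le> 9 / 4"
  proof -
    have T2_le: "T\<^sup>2 \<le> 1.6\<^sup>2"
      unfolding T2 using Q by (simp add: divide_le_eq power_divide)
    then have "T \<le> 1.6" by (rule power2_le_imp_le) simp
    then have "T / 2 * T\<^sup>2 \<le> 1.6 / 2 * 1.6\<^sup>2"
      using T2_le T_pos by (intro mult_mono) auto
    also have "\<dots> \<le> 9 / 4" by (simp add: power2_eq_square)
    finally show ?thesis .
  qed
  ultimately have kT: "k * T\<^sup>2 \<le> 9 / 4"
    by (simp add: k_def max_def)
  have "k > 0" using assms(1) by (simp add: k_def)
  have "(sqrt k * T)\<^sup>2 \<le> (3 / 2)\<^sup>2"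
    using kT \<open>k > 0\<close> by (simp add: power_mult_distrib) (simp add: power2_eq_square)
  then have "sqrt k * T \<le> 3 / 2"
    by (rule power2_le_imp_le) simp
  then have "sqrt k * T < pi / 2"
    using pi_gt3 by simp
  then have "{0..<T} \<subseteq> I_s"
    using no_blowup_before[OF assms(2,1), of k T] T_pos by (simp add: k_def)
  then have "{0..<T} \<subseteq> {0..<t_inf}"
    using assms(4) by fastforce
  then have "T \<le> t_inf"
    using T_pos by simp
  moreover have "2 / sqrt Q < T"
    unfolding T_def using Q by (intro divide_strict_right_mono) auto
  ultimately show ?thesis by (simp add: Q_def)
qed

end
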